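(* There exist an infinite set $S$ of positive integers and, for each $N \in S$, a Newman polynomial $p_N$ of degree $N$ such that $$ \liminf_{N \to \infty,\ N \in S} \frac{N\, \|p_N^2\|_\infty}{p_N^2(1)} < 1 $$ and $$ \frac{p_N(1)}{N} \to 0 \quad \text{as } N \to \infty,\ N \in S. $$
   Context: A Newman polynomial is a polynomial in one variable all of whose coefficients are 0 or 1. For a polynomial $q$, $\|q\|_\infty$ denotes the maximum of the absolute values of its coefficients. Here $p_N^2$ is the square of the polynomial $p_N$, and $p_N^2(1) = (p_N(1))^2$ is its value at $1$. *)

theory Defs
  imports Complex_Main "HOL-Computational_Algebra.Polynomial" "HOL-Library.Extended_Real"
    "HOL-Library.Liminf_Limsup"
begin

definition newman_poly :: "real poly \<Rightarrow> bool" where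
  "newman_poly p \<longleftrightarrow> (\<forall>i\<le>degree p. coeff p i \<in> {0, 1})"

definition coeff_norm :: "real poly \<Rightarrow> real" where
  "coeff_norm q = Max ((\<lambda>i. \<bar>coeff q i\<bar>) ` {..degree q})"

text \<open>The filter for limits as \<open>N\<close> tends to infinity through the elements of \<open>S\<close>.
  It is nontrivial exactly when \<open>S\<close> is infinite.\<close>

definition at_top_in :: "nat set \<Rightarrow> nat filter" where
  "at_top_in S = inf at_top (principal S)"

end

theory Submission
  imports Defs
begin

text \<open>
  If \<open>A \<subseteq> \<int>/n\<close> has at most \<open>G\<close> representations of each residue as a sum, and \<open>B\<close> has at most
  \<open>R\<close> representations of each integer, then the set of integers with last base-\<open>n\<close> digit in \<open>A\<close>
  and remaining part in \<open>B\<close> has at most \<open>G R\<close> representations. Hence such a step multiplies the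
  ratio in question by at most \<open>n G / |A|\<^sup>2\<close>, and the density by \<open>|A| / n\<close>. Start from
  \<open>B = {0, 1, 3}\<close>, whose ratio is at most \<open>4 \<cdot> 2 / 9 < 1\<close>, and let \<open>A\<close> be the complement of a Sidon set
  of size \<open>d\<close>: then \<open>n G / |A|\<^sup>2\<close> is \<open>1 + O(1/n)\<close>, while the density drops by \<open>1 - d/n\<close>. About
  \<open>n / \<surd>d\<close> such steps send the density to \<open>0\<close> and increase the ratio by a factor tending to \<open>1\<close>.
\<close>

section \<open>Counting representations as sums\<close>

text \<open>Ordered pairs are counted through their first entry. The guard \<open>b \<le> s\<close>
  excludes larger \<open>b\<close>, for which truncated subtraction would give
  \<open>s - b = 0\<close>.\<close>

definition rep :: "nat set \<Rightarrow> nat \<Rightarrow> nat" where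
  "rep B s = card {b\<in>B. b \<le> s \<and> s - b \<in> B}"

text \<open>For \<open>A \<subseteq> {..<n}\<close> the first summand determines the second, so this
  counts ordered representations of a residue.\<close>

definition mrep :: "nat \<Rightarrow> nat set \<Rightarrow> nat \<Rightarrow> nat" where
  "mrep n A s = card {a\<in>A. \<exists>a'\<in>A. (a + a') mod n = s mod n}"

definition digit_set :: "nat \<Rightarrow> nat set \<Rightarrow> nat set \<Rightarrow> nat set" where
  "digit_set n A B = {c. c mod n \<in> A \<and> c div n \<in> B}"

lemma digit_set_eq_image:
  assumes "A \<subseteq> {..<n}"
  shows "digit_set n A B = (\<lambda>(a, b). a + n * b) ` (A \<times> B)"
proof (intro equalityI subsetI)
  fix c assume "c \<in> digit_set n A B"
  then have "(c mod n, c div n) \<in> A \<times> B" by (auto simp: digit_set_def)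
  moreover have "c = (\<lambda>(a, b). a + n * b) (c mod n, c div n)" by simp
  ultimately show "c \<in> (\<lambda>(a, b). a + n * b) ` (A \<times> B)" by (rule rev_image_eqI)
next
  fix c assume "c \<in> (\<lambda>(a, b). a + n * b) ` (A \<times> B)"
  then obtain a b where "c = a + n * b" "a \<in> A" "b \<in> B" by auto
  then show "c \<in> digit_set n A B" using assms by (auto simp: digit_set_def)
qed

lemma card_digit_set:
  assumes "A \<subseteq> {..<n}"
  shows "card (digit_set n A B) = card A * card B"
proof -
  have "inj_on (\<lambda>(a, b). a + n * b) (A \<times> B)"
  proof (rule inj_onI, clarify)
    fix a b a' b' assume "a \<in> A" "a' \<in> A" and eq: "a + n * b = a' + n * b'"
    then have lt: "a < n" "a' < n" using assms by auto
    from eq have "(a + n * b) mod n = (a' + n * b') mod n" "(a + n * b) div n = (a' + n * b') div n"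
      by simp_all
    with lt show "a = a' \<and> b = b'" by simp
  qed
  then show ?thesis by (simp add: digit_set_eq_image[OF assms] card_image card_cartesian_product)
qed

lemma finite_digit_set:
  assumes "A \<subseteq> {..<n}" "finite B"
  shows "finite (digit_set n A B)"
  using assms by (simp add: digit_set_eq_image finite_subset)

text \<open>Once the last digit \<open>a\<close> of the first summand is chosen, that of the second
  is forced. This fixes the carry, hence also the sum of the two higher parts. There are at most
  \<open>G\<close> choices of \<open>a\<close>, each leaving at most \<open>R\<close> choices of the
  higher part.\<close>

lemma rep_digit_set_le:
  assumes A: "A \<subseteq> {..<n}" and B: "finite B"
    and G: "\<And>s. mrep n A s \<le> G" and R: "\<And>s. rep B s \<le> R"
  shows "rep (digit_set n A B) s \<le> G * R"
proof -
  define A' where "A' = {a\<in>A. \<exists>a'\<in>A. (a + a') mod n = s mod n}"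
  \<comment> \<open>\<open>(s + (n - a)) mod n\<close> is the forced last digit, namely
    \<open>s - a\<close> modulo \<open>n\<close>; \<open>t a\<close> is the sum required of the
    higher parts.\<close>
  define t where "t a = (s - (a + (s + (n - a)) mod n)) div n" for a
  define T where "T = (SIGMA a:A'. {b\<in>B. b \<le> t a \<and> t a - b \<in> B})"
  define X where "X = {c\<in>digit_set n A B. c \<le> s \<and> s - c \<in> digit_set n A B}"
  have finA: "finite A'" using A finite_subset unfolding A'_def by fastforce
  have "(\<lambda>c. (c mod n, c div n)) ` X \<subseteq> T"
  proof clarify
    fix u assume "u \<in> X"
    then obtain v where s: "s = u + v"
      and u: "u mod n \<in> A" "u div n \<in> B" and v: "v mod n \<in> A" "v div n \<in> B"
      by (auto simp: X_def digit_set_def le_iff_add)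
    have n: "n > 0" using u A by auto
    have "(s + (n - u mod n)) mod n = (n * Suc (u div n) + v) mod n"
    proof -
      have "u mod n + n * (u div n) = u" "u mod n < n" using n by simp_all
      then have "s + (n - u mod n) = n * Suc (u div n) + v"
        using s unfolding mult_Suc_right by linarith
      then show ?thesis by simp
    qed
    then have "(s + (n - u mod n)) mod n = v mod n" by (metis mod_mult_self4)
    moreover have "s = (u mod n + v mod n) + n * (u div n + v div n)"
      by (simp add: s distrib_left)
    ultimately have "t (u mod n) = (n * (u div n + v div n)) div n"
      unfolding t_def by (metis diff_add_inverse)
    then have "t (u mod n) = u div n + v div n" using n by simp
    moreover have "u mod n \<in> A'" using u v s unfolding A'_def
      by (auto intro!: bexI[of _ "v mod n"] simp: mod_add_eq)
    ultimately show "(u mod n, u div n) \<in> T" using u v by (auto simp: T_def)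
  qed
  moreover have "inj_on (\<lambda>c. (c mod n, c div n)) X"
    by (rule inj_onI) (metis div_mult_mod_eq prod.inject)
  moreover have "finite T" using finA B by (auto simp: T_def)
  ultimately have "card X \<le> card T" by (metis card_inj_on_le)
  also have "\<dots> = (\<Sum>a\<in>A'. rep B (t a))"
    using finA B by (simp add: T_def rep_def)
  also have "\<dots> \<le> card A' * R" using sum_bounded_above[of A' "\<lambda>a. rep B (t a)" R] R by simp
  also have "\<dots> \<le> G * R" using G[of s] by (simp add: A'_def mrep_def)
  finally show ?thesis by (simp add: rep_def X_def)
qed

section \<open>Complements of Sidon sets\<close>

text \<open>Inclusion-exclusion: a first summand must avoid both \<open>D\<close> and its reflection
  \<open>s - D\<close> modulo \<open>n\<close>. These have at least \<open>2 * card D - g\<close>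
  elements together, since their intersection is counted by \<open>mrep n D s\<close>.\<close>

lemma mrep_complement_le:
  assumes D: "D \<subseteq> {..<n}" and g: "mrep n D s \<le> g"
  shows "mrep n ({..<n} - D) s + 2 * card D \<le> n + g"
proof (cases "n = 0")
  case True
  then show ?thesis using D by (simp add: mrep_def)
next
  case n: False
  \<comment> \<open>The reflection \<open>s - D\<close> modulo \<open>n\<close>.\<close>
  define E where "E = {a. a < n \<and> (\<exists>x\<in>D. (a + x) mod n = s mod n)}"
  have finD: "finite D" using D finite_subset by blast
  have cancel: "x = y" if xy: "x < n" "y < n" "(a + x) mod n = (a + y) mod n" for a x y
  proof -
    obtain q r where "a + x + n * q = a + y + n * r" using xy(3) nat_mod_eq_iff by metis
    then have "x + n * q = y + n * r" by simp
    then have "x mod n = y mod n" unfolding nat_mod_eq_iff by blast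
    then show ?thesis using xy by simp
  qed
  have inj: "inj_on (\<lambda>x. (s + (n - x)) mod n) D"
  proof (rule inj_onI)
    fix x y assume xy: "x \<in> D" "y \<in> D" and eq: "(s + (n - x)) mod n = (s + (n - y)) mod n"
    have lt: "x < n" "y < n" using xy D by auto
    \<comment> \<open>Adding \<open>x + y\<close> undoes both reflections without leaving the
      naturals.\<close>
    have "(s + (n - x) + (x + y)) mod n = (s + (n - y) + (x + y)) mod n"
      using eq by (metis mod_add_left_eq)
    moreover have "s + (n - x) + (x + y) = (s + n) + y" "s + (n - y) + (x + y) = (s + n) + x"
      using lt by simp_all
    ultimately have "(s + n + y) mod n = (s + n + x) mod n" by (simp only:)
    then show "x = y" using cancel[of y x "s + n"] lt by simp
  qed
  have "(\<lambda>x. (s + (n - x)) mod n) ` D \<subseteq> E"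
  proof clarify
    fix x assume x: "x \<in> D"
    then have "x < n" using D by auto
    then have "s + (n - x) + x = s + n" by simp
    then have "((s + (n - x)) mod n + x) mod n = s mod n"
      by (metis mod_add_left_eq mod_add_self2)
    then show "(s + (n - x)) mod n \<in> E" using x n by (auto simp: E_def)
  qed
  moreover have finE: "finite E" by (simp add: E_def)
  ultimately have cE: "card D \<le> card E" using inj by (metis card_inj_on_le)
  have "D \<inter> E = {a\<in>D. \<exists>x\<in>D. (a + x) mod n = s mod n}" using D by (auto simp: E_def)
  then have "card (D \<inter> E) \<le> g" using g by (simp add: mrep_def)
  then have *: "2 * card D \<le> card (D \<union> E) + g" using card_Un_Int[OF finD finE] cE by simp
  \<comment> \<open>The partner of \<open>a\<close> is unique modulo \<open>n\<close>, so it cannot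
    lie both in \<open>D\<close> and outside it.\<close>
  have "a \<notin> E" if a: "a' < n" "a' \<notin> D" "(a + a') mod n = s mod n" for a a'
  proof
    assume "a \<in> E"
    then obtain x where x: "x \<in> D" "(a + x) mod n = s mod n" by (auto simp: E_def)
    then have "x = a'" using D a by (intro cancel[of x a' a]) auto
    then show False using x a by simp
  qed
  then have "{a\<in>{..<n} - D. \<exists>a'\<in>{..<n} - D. (a + a') mod n = s mod n} \<subseteq> {..<n} - (D \<union> E)"
    by blast
  then have "mrep n ({..<n} - D) s \<le> card ({..<n} - (D \<union> E))"
    unfolding mrep_def by (intro card_mono) auto
  also have "\<dots> = n - card (D \<union> E)"
    using D finD finE by (subst card_Diff_subset) (auto simp: E_def)
  finally have "mrep n ({..<n} - D) s \<le> n - card (D \<union> E)" .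
  moreover have "card (D \<union> E) \<le> n"
    using D card_mono[of "{..<n}" "D \<union> E"] by (auto simp: E_def)
  ultimately show ?thesis using * by linarith
qed

text \<open>A sum of two powers of 3 lies between its larger power and twice that power, so its size
  reveals the larger exponent.\<close>

lemma max_exponent_unique:
  fixes a b c e :: nat
  assumes "(3::nat) ^ a + 3 ^ b = 3 ^ c + 3 ^ e"
  shows "max a b = max c e"
proof -
  have bound: "(3::nat) ^ max a b \<le> 3 ^ a + 3 ^ b \<and> (3::nat) ^ a + 3 ^ b < 3 ^ Suc (max a b)" for a b
  proof -
    have "(3::nat) ^ a \<le> 3 ^ max a b" "(3::nat) ^ b \<le> 3 ^ max a b" by (auto intro: power_increasing)
    moreover have "(3::nat) ^ max a b > 0" by simp
    ultimately have "(3::nat) ^ a + 3 ^ b < 3 ^ Suc (max a b)" unfolding power_Suc by linarith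
    then show ?thesis by (simp add: max_def)
  qed
  have "(3::nat) ^ max a b < 3 ^ Suc (max c e)" "(3::nat) ^ max c e < 3 ^ Suc (max a b)"
    using bound[of a b] bound[of c e] assms by linarith+
  then have "max a b < Suc (max c e)" "max c e < Suc (max a b)"
    by (auto dest: power_less_imp_less_exp[rotated] simp del: power_Suc)
  then show ?thesis by linarith
qed

text \<open>The sums stay below \<open>3 ^ d\<close>, so reduction changes nothing. The larger power
  is then determined, and the first summand is either that power or the remainder.\<close>

lemma mrep_powers_of_3_le: "mrep (3 ^ d) ((^) 3 ` {..<d}) s \<le> 2"
proof -
  define r where "r = s mod 3 ^ d"
  define X where "X = {x\<in>(^) 3 ` {..<d}. \<exists>y\<in>(^) 3 ` {..<d}. (x + y) mod 3 ^ d = (r::nat)}"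
  have no_wrap: "((3::nat) ^ a + 3 ^ b) mod 3 ^ d = 3 ^ a + 3 ^ b" if "a < d" "b < d" for a b
  proof -
    have "(3::nat) ^ Suc a \<le> 3 ^ d" "(3::nat) ^ Suc b \<le> 3 ^ d"
      using that by (intro power_increasing; simp)+
    then have "3 * (3::nat) ^ a \<le> 3 ^ d" "3 * (3::nat) ^ b \<le> 3 ^ d" by simp_all
    moreover have "(3::nat) ^ d > 0" by simp
    ultimately have "(3::nat) ^ a + 3 ^ b < 3 ^ d" by linarith
    then show ?thesis by simp
  qed
  have X: "\<exists>a b. a < d \<and> b < d \<and> x = 3 ^ a \<and> 3 ^ a + 3 ^ b = r" if "x \<in> X" for x
    using that no_wrap unfolding X_def by force
  have "card X \<le> 2"
  proof (cases "X = {}")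
    case False
    then obtain a b where ab: "3 ^ a + 3 ^ b = r" using X by blast
    have "X \<subseteq> {3 ^ max a b, r - 3 ^ max a b}"
    proof
      fix x assume "x \<in> X"
      then obtain c e where ce: "x = 3 ^ c" "3 ^ c + 3 ^ e = r" using X by blast
      then have "max a b = max c e" using ab by (intro max_exponent_unique) simp
      then show "x \<in> {3 ^ max a b, r - 3 ^ max a b}" using ce by (auto simp: max_def)
    qed
    then have "card X \<le> card {3 ^ max a b, r - 3 ^ max a b}" by (intro card_mono) auto
    also have "\<dots> \<le> 2" by (simp add: card_insert_if)
    finally show ?thesis .
  qed simp
  then show ?thesis by (simp add: mrep_def X_def r_def)
qed

section \<open>Iteration\<close>

lemma rep_base_le: "rep {0, 1, 3} s \<le> 2"
proof -
  \<comment> \<open>Sums of two distinct elements are 1, 3 and 4; any other \<open>s\<close> can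
    only be a double, with first summand \<open>s div 2\<close>.\<close>
  have "{b\<in>{0, 1, 3}. b \<le> s \<and> s - b \<in> {0, 1, 3::nat}} \<subseteq>
    (if s = 1 then {0, 1} else if s = 3 then {0, 3} else if s = 4 then {1, 3} else {s div 2})"
    by auto
  then have "rep {0, 1, 3} s \<le> card
    (if s = 1 then {0, 1} else if s = 3 then {0, 3} else if s = 4 then {1, 3} else {s div 2})"
    unfolding rep_def by (intro card_mono) auto
  also have "\<dots> \<le> 2" by (simp add: card_insert_if)
  finally show ?thesis .
qed

text \<open>Digits from \<open>A\<close> are appended at the low end of \<open>{0, 1, 3}\<close>.
  The leading part therefore stays at most 3, and attains 3, which locates the maximum between
  \<open>3 * n ^ m\<close> and \<open>4 * n ^ m\<close>.\<close>

lemma iterated_digit_set: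
  assumes A: "A \<subseteq> {..<n}" "A \<noteq> {}" and G: "\<And>s. mrep n A s \<le> G"
  shows "\<exists>B. finite B \<and> B \<subseteq> {..<4 * n ^ m} \<and> (\<exists>b\<in>B. 3 * n ^ m \<le> b)
    \<and> card B = 3 * card A ^ m \<and> (\<forall>s. rep B s \<le> 2 * G ^ m)"
proof (induction m)
  case 0
  show ?case by (rule exI[of _ "{0, 1, 3}"]) (use rep_base_le in auto)
next
  case (Suc m)
  then obtain B b where B: "finite B" "B \<subseteq> {..<4 * n ^ m}" "b \<in> B" "3 * n ^ m \<le> b"
    "card B = 3 * card A ^ m" "\<And>s. rep B s \<le> 2 * G ^ m" by blast
  obtain a where a: "a \<in> A" using A by blast
  let ?C = "digit_set n A B"
  have n: "n > 0" using a A by auto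
  have "?C \<subseteq> {..<4 * n ^ Suc m}"
  proof
    fix c assume "c \<in> ?C"
    then have "c div n < 4 * n ^ m" using B by (auto simp: digit_set_def)
    then have "c < 4 * n ^ m * n" using n by (simp add: div_less_iff_less_mult)
    then show "c \<in> {..<4 * n ^ Suc m}" by (simp add: ac_simps)
  qed
  moreover have "a + n * b \<in> ?C" using a B A by (auto simp: digit_set_def)
  moreover have "3 * n ^ Suc m \<le> a + n * b"
  proof -
    have "3 * n ^ Suc m = n * (3 * n ^ m)" by simp
    also have "\<dots> \<le> n * b" using B(4) by (rule mult_le_mono2)
    finally show ?thesis by (rule trans_le_add2)
  qed
  moreover have "rep ?C s \<le> 2 * G ^ Suc m" for s
    using rep_digit_set_le[OF A(1) B(1) G B(6), of s] by (simp add: ac_simps)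
  ultimately show ?case
    using finite_digit_set[OF A(1) B(1)] card_digit_set[OF A(1), of B] B(5)
    by (intro exI[of _ ?C]) auto
qed

lemma sparse_set_exists:
  fixes K :: nat
  assumes K: "K \<ge> 200"
  shows "\<exists>C N R. finite C \<and> C \<subseteq> {..N} \<and> N \<in> C \<and> K \<le> N \<and> K * card C \<le> N
    \<and> (\<forall>s. rep C s \<le> R) \<and> real N * real R \<le> 0.98 * (real (card C))\<^sup>2"
proof -
  \<comment> \<open>With \<open>m\<close> about \<open>n / K\<close>, the exponent
    \<open>m * d / n\<close> of the density decay is at least \<open>K\<close>, while the
    accumulated error, of order \<open>m / n\<close>, is at most of order \<open>1 / K\<close>. The
    \<open>+ 1\<close> in \<open>m\<close> compensates for rounding down.\<close>
  define d n where "d = K\<^sup>2" and "n = (3::nat) ^ d"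
  define m where "m = n div K + 1"
  define D where "D = (^) (3::nat) ` {..<d}"
  define A where "A = {..<n} - D"
  have d2: "2 * d < n"
  proof -
    have "2 * i < 3 ^ i" for i :: nat by (induction i) auto
    then show ?thesis by (simp add: n_def)
  qed
  have Kd: "K \<le> d" by (simp add: d_def power2_eq_square)
  have D: "D \<subseteq> {..<n}" by (auto simp: D_def n_def)
  have cD: "card D = d" by (simp add: D_def card_image inj_on_def)
  have cA: "card A = n - d" using D cD by (simp add: A_def card_Diff_subset finite_subset)
  have "A \<noteq> {}" using cA d2 by auto
  then have A: "A \<subseteq> {..<n}" "A \<noteq> {}" by (simp_all add: A_def)
  have G: "mrep n A s \<le> n + 2 - 2 * d" for s
    using mrep_complement_le[OF D, of s 2] mrep_powers_of_3_le[of d s] cD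
    by (simp add: A_def n_def D_def)
  obtain C b where C: "finite C" "C \<subseteq> {..<4 * n ^ m}" "b \<in> C" "3 * n ^ m \<le> b"
    "card C = 3 * card A ^ m" "\<And>s. rep C s \<le> 2 * (n + 2 - 2 * d) ^ m"
    using iterated_digit_set[OF A G, of m] by blast
  define N where "N = Max C"
  have "N \<in> C" unfolding N_def using C(1,3) by (intro Max_in) auto
  moreover have "c \<le> N" if "c \<in> C" for c using C(1) that by (simp add: N_def)
  ultimately have N: "N \<in> C" "C \<subseteq> {..N}" "3 * n ^ m \<le> N" "N < 4 * n ^ m"
    using C(2) le_trans[OF C(4)] C(3) by auto
  have npos: "real n > 0" and Kpos: "real K > 0" using d2 K by auto
  have mlow: "real n / real K \<le> real m"
  proof -
    have "n < m * K" using K by (simp add: m_def dividend_less_div_times)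
    then have "real n \<le> real m * real K" by (metis less_imp_le of_nat_le_iff of_nat_mult)
    then show ?thesis using Kpos by (simp add: divide_simps)
  qed
  have mupp: "real m \<le> 2 * real n / real K"
  proof -
    have "real (n div K) \<le> real n / real K" by (rule of_nat_div_le_of_nat)
    moreover have "1 \<le> real n / real K" using Kd d2 Kpos by (simp add: divide_simps)
    ultimately show ?thesis by (simp add: m_def)
  qed
  \<comment> \<open>The density factor satisfies \<open>(1 - d/n)^m \<le> exp (- m * d / n) \<le>
    exp (- K) \<le> 1 / K\<close>.\<close>
  have dens: "real K * real (card A) ^ m \<le> real n ^ m"
  proof -
    have "real (card A) = real n * (1 - real d / real n)"
      using cA d2 npos by (simp add: field_simps)
    also have "\<dots> \<le> real n * exp (- (real d / real n))"
      using npos exp_ge_add_one_self[of "- (real d / real n)"] by simp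
    finally have "real (card A) ^ m \<le> (real n * exp (- (real d / real n))) ^ m"
      by (rule power_mono) simp
    also have "\<dots> = real n ^ m * exp (- (real m * (real d / real n)))"
      by (simp add: power_mult_distrib flip: exp_of_nat_mult)
    also have "\<dots> \<le> real n ^ m * exp (- real K)"
    proof -
      have "real K = real n / real K * (real d / real n)"
        using npos Kpos by (simp add: d_def power2_eq_square)
      also have "\<dots> \<le> real m * (real d / real n)" by (intro mult_right_mono mlow) simp
      finally show ?thesis by (intro mult_left_mono) simp_all
    qed
    also have "\<dots> \<le> real n ^ m * (1 / real K)"
    proof -
      have "real K \<le> exp (real K)" using exp_ge_add_one_self[of "real K"] by linarith
      then have "exp (- real K) \<le> 1 / real K" using Kpos by (simp add: exp_minus field_simps)
      then show ?thesis by (intro mult_left_mono) auto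
    qed
    finally show ?thesis using Kpos by (simp add: field_simps)
  qed
  \<comment> \<open>Completing the square bounds \<open>n * (n + 2 - 2 * d)\<close> by
    \<open>(n - d)^2 + 2 * n\<close>, and \<open>n - d \<ge> n / 2\<close> turns this into a factor
    \<open>1 + 8 / n\<close> per step.\<close>
  have ratio: "(real n * real (n + 2 - 2 * d)) ^ m \<le> 1.1 * (real (card A) ^ m)\<^sup>2"
  proof -
    define k where "k = real (card A)"
    have k: "k = real n - real d" "k \<ge> real n / 2" using cA d2 by (simp_all add: k_def)
    have G': "real (n + 2 - 2 * d) = real n + 2 - 2 * real d" using d2 by simp
    have "(real n / 2)\<^sup>2 \<le> k\<^sup>2" using k(2) npos by (intro power_mono) auto
    then have "2 * real n \<le> 8 / real n * k\<^sup>2"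
      using npos by (simp add: field_simps power2_eq_square)
    moreover have "real n * (real n + 2 - 2 * real d) \<le> k\<^sup>2 + 2 * real n"
      by (simp add: k(1) power2_eq_square algebra_simps)
    ultimately have "real n * real (n + 2 - 2 * d) \<le> k\<^sup>2 * (1 + 8 / real n)"
      unfolding G' by (simp add: algebra_simps)
    also have "\<dots> \<le> k\<^sup>2 * exp (8 / real n)"
      by (intro mult_left_mono exp_ge_add_one_self) auto
    finally have "(real n * real (n + 2 - 2 * d)) ^ m \<le> (k\<^sup>2 * exp (8 / real n)) ^ m"
      by (rule power_mono) simp
    also have "\<dots> = (k ^ m)\<^sup>2 * exp (real m * (8 / real n))"
      by (simp add: power_mult_distrib power_mult[symmetric] mult.commute flip: exp_of_nat_mult)
    also have "\<dots> \<le> (k ^ m)\<^sup>2 * 1.1"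
    proof -
      have "real m * (8 / real n) \<le> 2 * real n / real K * (8 / real n)"
        by (intro mult_right_mono mupp) simp
      also have "\<dots> = 16 / real K" using npos by simp
      \<comment> \<open>The threshold 200 is chosen here: \<open>16 / 200 = 0.08\<close>, and
        \<open>exp 0.08 < 1.1\<close>.\<close>
      also have "\<dots> \<le> 0.08" using K by (simp add: field_simps)
      finally have "exp (real m * (8 / real n)) \<le> exp (0.08)" by simp
      also have "\<dots> \<le> 1 + 0.08 + (0.08::real)\<^sup>2" by (rule exp_bound) auto
      also have "\<dots> \<le> 1.1" by (simp add: power2_eq_square)
      finally show ?thesis by (intro mult_left_mono) auto
    qed
    finally show ?thesis by (simp add: k_def)
  qed
  have "K * card C \<le> N"
  proof -
    have "real (K * card A ^ m) \<le> real (n ^ m)" using dens by simp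
    then have "K * card A ^ m \<le> n ^ m" by linarith
    then show ?thesis using N(3) C(5) by simp
  qed
  moreover have "K \<le> N"
  proof -
    have "card C \<ge> 1" using C(1,3) by (auto simp: Suc_le_eq card_gt_0_iff)
    then have "K * 1 \<le> K * card C" by (rule mult_le_mono2)
    then show ?thesis using \<open>K * card C \<le> N\<close> by linarith
  qed
  \<comment> \<open>The base set contributes \<open>4 * 2 / 9\<close>; with the error 1.1 the
    comparison is \<open>8.8 \<le> 0.98 * 9 = 8.82\<close>.\<close>
  moreover have "real N * real (2 * (n + 2 - 2 * d) ^ m) \<le> 0.98 * (real (card C))\<^sup>2"
  proof -
    have "real N \<le> real (4 * n ^ m)" using N(4) by linarith
    then have "real N * real (2 * (n + 2 - 2 * d) ^ m)
        \<le> real (4 * n ^ m) * real (2 * (n + 2 - 2 * d) ^ m)"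
      by (rule mult_right_mono) simp
    also have "\<dots> = 8 * (real n * real (n + 2 - 2 * d)) ^ m"
      by (simp only: of_nat_mult of_nat_power power_mult_distrib)
    also have "\<dots> \<le> 8.8 * (real (card A) ^ m)\<^sup>2" using ratio by simp
    also have "\<dots> \<le> 0.98 * (9 * (real (card A) ^ m)\<^sup>2)" by simp
    also have "\<dots> = 0.98 * (real (card C))\<^sup>2" by (simp add: C(5) power_mult_distrib)
    finally show ?thesis .
  qed
  ultimately show ?thesis using C(1,6) N(1,2) by blast
qed

section \<open>Passing to polynomials\<close>

definition set_poly :: "nat set \<Rightarrow> real poly" where
  "set_poly C = (\<Sum>c\<in>C. monom 1 c)"

lemma coeff_set_poly: "finite C \<Longrightarrow> coeff (set_poly C) i = of_bool (i \<in> C)"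
  by (simp add: set_poly_def coeff_sum)

lemma poly_set_poly_1: "poly (set_poly C) 1 = real (card C)"
  by (simp add: set_poly_def poly_sum poly_monom)

lemma degree_set_poly:
  assumes "finite C" "C \<subseteq> {..N}" "N \<in> C"
  shows "degree (set_poly C) = N"
proof (rule antisym)
  show "degree (set_poly C) \<le> N"
    using assms by (intro degree_le) (auto simp: coeff_set_poly)
  show "N \<le> degree (set_poly C)"
    using assms by (intro le_degree) (simp add: coeff_set_poly)
qed

lemma newman_set_poly: "finite C \<Longrightarrow> newman_poly (set_poly C)"
  by (simp add: newman_poly_def coeff_set_poly)

lemma coeff_set_poly_square:
  assumes "finite C"
  shows "coeff ((set_poly C)\<^sup>2) s = real (rep C s)"
proof -
  have "coeff ((set_poly C)\<^sup>2) s = (\<Sum>i\<le>s. of_bool (i \<in> C \<and> s - i \<in> C))"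
    by (simp add: power2_eq_square coeff_mult coeff_set_poly[OF assms] flip: of_bool_conj)
  also have "\<dots> = real (card {i\<in>{..s}. i \<in> C \<and> s - i \<in> C})"
    by (simp add: Int_def)
  also have "{i\<in>{..s}. i \<in> C \<and> s - i \<in> C} = {b\<in>C. b \<le> s \<and> s - b \<in> C}" by auto
  finally show ?thesis by (simp add: rep_def)
qed

lemma coeff_norm_set_poly_square_le:
  assumes "finite C" "\<And>s. rep C s \<le> R"
  shows "coeff_norm ((set_poly C)\<^sup>2) \<le> real R"
  unfolding coeff_norm_def using assms by (auto simp: coeff_set_poly_square)

text \<open>One parameter \<open>K\<close> forces large degree and small density together, while the
  ratio bound 0.98 is uniform in \<open>K\<close>.\<close>

lemma sparse_newman_poly_exists:
  fixes K :: nat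
  assumes "K \<ge> 200"
  shows "\<exists>p. newman_poly p \<and> K \<le> degree p \<and> 0 \<le> poly p 1
    \<and> real K * poly p 1 \<le> real (degree p)
    \<and> real (degree p) * coeff_norm (p\<^sup>2) / poly (p\<^sup>2) 1 \<le> 0.98"
proof -
  obtain C N R where C: "finite C" "C \<subseteq> {..N}" "N \<in> C" "K \<le> N" "K * card C \<le> N"
    "\<And>s. rep C s \<le> R" "real N * real R \<le> 0.98 * (real (card C))\<^sup>2"
    using sparse_set_exists[OF assms] by blast
  have "real N * coeff_norm ((set_poly C)\<^sup>2) \<le> real N * real R"
    using coeff_norm_set_poly_square_le[OF C(1,6)] by (intro mult_left_mono) auto
  moreover have "card C > 0" using C(1,3) by (auto simp: card_gt_0_iff)
  ultimately have "real N * coeff_norm ((set_poly C)\<^sup>2) / (real (card C))\<^sup>2 \<le> 0.98"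
    using C(7) by (simp add: divide_le_eq)
  moreover have "real K * real (card C) \<le> real N"
    using C(5) by (metis of_nat_le_iff of_nat_mult)
  ultimately show ?thesis
    using C(1,4) by (intro exI[of _ "set_poly C"])
      (simp add: newman_set_poly degree_set_poly[OF C(1-3)] poly_set_poly_1)
qed

section \<open>Limits along the set of degrees\<close>

lemma eventually_at_top_in:
  "eventually P (at_top_in S) \<longleftrightarrow> (\<exists>M. \<forall>N\<ge>M. N \<in> S \<longrightarrow> P N)"
  by (simp add: at_top_in_def eventually_inf_principal eventually_at_top_linorder)

theorem mainTheorem2:
  "\<exists>(S :: nat set) (p :: nat \<Rightarrow> real poly).
     infinite S \<and> S \<subseteq> {0<..} \<and>
     (\<forall>N\<in>S. newman_poly (p N) \<and> degree (p N) = N) \<and>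
     Liminf (at_top_in S)
       (\<lambda>N. ereal (real N * coeff_norm ((p N)\<^sup>2) / poly ((p N)\<^sup>2) 1)) < 1 \<and>
     ((\<lambda>N. poly (p N) 1 / real N) \<longlongrightarrow> 0) (at_top_in S)"
proof -
  have "\<forall>j. \<exists>p. newman_poly p \<and> j + 200 \<le> degree p \<and> 0 \<le> poly p 1
    \<and> real (j + 200) * poly p 1 \<le> real (degree p)
    \<and> real (degree p) * coeff_norm (p\<^sup>2) / poly (p\<^sup>2) 1 \<le> 0.98"
    by (intro allI sparse_newman_poly_exists) simp
  then obtain q where q: "\<And>j. newman_poly (q j)" "\<And>j. j + 200 \<le> degree (q j)"
    "\<And>j. 0 \<le> poly (q j) 1" "\<And>j. real (j + 200) * poly (q j) 1 \<le> real (degree (q j))"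
    "\<And>j. real (degree (q j)) * coeff_norm ((q j)\<^sup>2) / poly ((q j)\<^sup>2) 1 \<le> 0.98"
    by metis
  define deg where "deg j = degree (q j)" for j
  define S where "S = range deg"
  \<comment> \<open>Several \<open>j\<close> may share a degree, so one index is chosen for each
    \<open>N \<in> S\<close>; values outside \<open>S\<close> are invisible to the filter.\<close>
  define ix where "ix = inv deg"
  define p where "p N = q (ix N)" for N
  have ix: "deg (ix N) = N" if "N \<in> S" for N
    using that by (simp add: ix_def S_def f_inv_into_f)
  then have deg_p: "degree (p N) = N" if "N \<in> S" for N
    using that by (simp add: p_def deg_def)
  have inf: "infinite S"
    unfolding infinite_nat_iff_unbounded_le S_def deg_def
    by (meson q(2) add_leE rangeI)
  \<comment> \<open>Needed to bound \<open>Liminf\<close> by \<open>Limsup\<close>: along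
    \<open>bot\<close> the \<open>Liminf\<close> would be infinite.\<close>
  have nontrivial: "at_top_in S \<noteq> bot"
  proof
    assume "at_top_in S = bot"
    then have "eventually (\<lambda>_. False) (at_top_in S)" by simp
    then obtain M where "\<forall>N\<ge>M. N \<notin> S" by (auto simp: eventually_at_top_in)
    then show False using inf by (auto simp: infinite_nat_iff_unbounded_le)
  qed
  have "Liminf (at_top_in S)
      (\<lambda>N. ereal (real N * coeff_norm ((p N)\<^sup>2) / poly ((p N)\<^sup>2) 1))
    \<le> Limsup (at_top_in S)
      (\<lambda>N. ereal (real N * coeff_norm ((p N)\<^sup>2) / poly ((p N)\<^sup>2) 1))"
    using nontrivial by (rule Liminf_le_Limsup)
  also have "\<dots> \<le> ereal 0.98"
  proof (rule Limsup_bounded)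
    show "\<forall>\<^sub>F N in at_top_in S.
      ereal (real N * coeff_norm ((p N)\<^sup>2) / poly ((p N)\<^sup>2) 1) \<le> ereal 0.98"
      unfolding eventually_at_top_in using q(5) deg_p by (metis ereal_less_eq(3) p_def)
  qed
  also have "\<dots> < 1" by simp
  finally have liminf: "Liminf (at_top_in S)
      (\<lambda>N. ereal (real N * coeff_norm ((p N)\<^sup>2) / poly ((p N)\<^sup>2) 1)) < 1" .
  have ix_top: "filterlim ix at_top (at_top_in S)"
    unfolding filterlim_at_top
  proof
    fix J
    \<comment> \<open>The sum dominates every degree with index below \<open>J\<close>, so a larger
      \<open>N\<close> must have index at least \<open>J\<close>.\<close>
    have "J \<le> ix N" if "N \<ge> Suc (\<Sum>j<J. deg j)" "N \<in> S" for N
    proof (rule ccontr)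
      assume "\<not> J \<le> ix N"
      then have "deg (ix N) \<le> (\<Sum>j<J. deg j)" by (intro member_le_sum) auto
      then show False using that ix by simp
    qed
    then show "\<forall>\<^sub>F N in at_top_in S. J \<le> ix N" unfolding eventually_at_top_in by blast
  qed
  have "((\<lambda>N. poly (p N) 1 / real N) \<longlongrightarrow> 0) (at_top_in S)"
  proof (rule tendsto_sandwich)
    show "\<forall>\<^sub>F N in at_top_in S. 0 \<le> poly (p N) 1 / real N"
      using q(3) by (simp add: p_def)
    have "poly (p N) 1 / real N \<le> inverse (real (ix N + 200))" if "N \<in> S" for N
    proof -
      have "real N > 0" using q(2)[of "ix N"] deg_p[OF that] by (simp add: p_def)
      moreover have "real (ix N + 200) * poly (p N) 1 \<le> real N"
        using q(4)[of "ix N"] deg_p[OF that] by (simp add: p_def)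
      ultimately show ?thesis by (simp add: field_simps)
    qed
    then show "\<forall>\<^sub>F N in at_top_in S. poly (p N) 1 / real N \<le> inverse (real (ix N + 200))"
      unfolding eventually_at_top_in by blast
    have "filterlim (\<lambda>N. real (ix N + 200)) at_top (at_top_in S)"
      using ix_top filterlim_compose[OF filterlim_real_sequentially]
        filterlim_compose[OF filterlim_add_const_nat_at_top] by blast
    then show "((\<lambda>N. inverse (real (ix N + 200))) \<longlongrightarrow> 0) (at_top_in S)"
      by (rule tendsto_inverse_0_at_top)
  qed simp
  moreover have "S \<subseteq> {0<..}"
  proof
    fix N assume "N \<in> S"
    then obtain j where "N = degree (q j)" by (auto simp: S_def deg_def)
    then show "N \<in> {0<..}" using q(2)[of j] by simp
  qed
  moreover have "\<forall>N\<in>S. newman_poly (p N) \<and> degree (p N) = N"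
    using q(1) deg_p by (auto simp: p_def)
  ultimately show ?thesis using inf liminf by blast
qed

end
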